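(* Consider a region discretized by the FDTD-Q scheme described in the context, with $0<\Delta t<\Delta t_{\mathrm{CFL,gen}}=2/\rho\!\left(\frac{1}{\hbar}(D_V'')^{-1/2}H(D_V'')^{-1/2}\right)$ ($\rho$ the spectral radius), and assume $\mathcal{I}_P^{n+\frac12}=0$ for all $n=0,1,\dots,n_t-1$. Then $$\|\psi^n\|_2\le\sqrt{\kappa(\mathbf{P})}\,\|\psi^0\|_2,\qquad n=0,1,\dots,n_t,$$ where $\kappa(\mathbf{P})$ is the (2-norm) condition number of $\mathbf{P}$.
   Context: Fix constants $\hbar>0$, $m>0$, cell sizes $\Delta x,\Delta y,\Delta z>0$, positive integers $n_x,n_y,n_z,n_t$ and a time step $\Delta t>0$. The region is a box made of $n_x\times n_y\times n_z$ primary cells of size $\Delta x\times\Delta y\times\Delta z$, with primary nodes $(i,j,k)$, $1\le i\le n_x+1$, $1\le j\le n_y+1$, $1\le k\le n_z+1$. Let $N=(n_x+1)(n_y+1)(n_z+1)$; vectors indexed by nodes use the ordering $i+(j-1)(n_x+1)+(k-1)(n_x+1)(n_y+1)$. Real potential values $U_{i,j,k}$ are given at the nodes; $D_U$ is the $N\times N$ diagonal matrix containing them. Let $I_p$ be the $p\times p$ identity, $\tilde I_p=\mathrm{diag}(\tfrac12,1,\dots,1,\tfrac12)$ ($p\times p$), $W_p=[0_{p\times1}\ I_p]-[I_p\ 0_{p\times 1}]$ ($p\times(p+1)$), $\otimes$ the Kronecker product, and $e\{p,q\}$ the $q\times 1$ vector with $1$ in position $p$ and zeros elsewhere. Define $D_V''=\Delta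 x\Delta y\Delta z\,\tilde I_{n_z+1}\otimes\tilde I_{n_y+1}\otimes\tilde I_{n_x+1}$; $D=[D_x\ D_y\ D_z]$ with $D_x=-I_{n_z+1}\otimes I_{n_y+1}\otimes W_{n_x}^T$, $D_y=-I_{n_z+1}\otimes W_{n_y}^T\otimes I_{n_x+1}$, $D_z=-W_{n_z}^T\otimes I_{n_y+1}\otimes I_{n_x+1}$; $D_S''=\mathrm{diag}(\Delta y\Delta z\,\tilde I_{n_z+1}\otimes\tilde I_{n_y+1}\otimes I_{n_x},\ \Delta x\Delta z\,\tilde I_{n_z+1}\otimes I_{n_y}\otimes\tilde I_{n_x+1},\ \Delta x\Delta y\,I_{n_z}\otimes\tilde I_{n_y+1}\otimes\tilde I_{n_x+1})$; $D_l'=\mathrm{diag}(\Delta x\, I_{n_x(n_y+1)(n_z+1)},\ \Delta y\, I_{(n_x+1)n_y(n_z+1)},\ \Delta z\, I_{(n_x+1)(n_y+1)n_z})$; $H=\frac{\hbar^2}{2m}D D_S''(D_l')^{-1}D^T+D_V''D_U$; $\mathbf{P}=\begin{bmatrix}D_V''&-\frac{\Delta t}{2\hbar}H\\-\frac{\Delta t}{2\hbar}H&D_V''\end{bmatrix}$. Boundary ("hanging") variables: $L=[L_W\ L_E\ L_S\ L_N\ L_B\ L_T]$ with $L_W=I_{n_z+1}\otimes I_{n_y+1}\otimes e\{1,n_x+1\}$, $L_E=I_{n_z+1}\otimes I_{n_y+1}\otimes e\{n_x+1,n_x+1\}$, $L_S=I_{n_z+1}\otimes e\{1,n_y+1\}\otimes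 I_{n_x+1}$, $L_N=I_{n_z+1}\otimes e\{n_y+1,n_y+1\}\otimes I_{n_x+1}$, $L_B=e\{1,n_z+1\}\otimes I_{n_y+1}\otimes I_{n_x+1}$, $L_T=e\{n_z+1,n_z+1\}\otimes I_{n_y+1}\otimes I_{n_x+1}$; let $M$ be the number of columns of $L$. $D_{\hat n}=\mathrm{diag}(-I_{(n_y+1)(n_z+1)},I_{(n_y+1)(n_z+1)},-I_{(n_x+1)(n_z+1)},I_{(n_x+1)(n_z+1)},-I_{(n_x+1)(n_y+1)},I_{(n_x+1)(n_y+1)})$; $D_{S,b}''=\mathrm{diag}(\Delta y\Delta z\,\tilde I_{n_z+1}\otimes\tilde I_{n_y+1},\ \Delta y\Delta z\,\tilde I_{n_z+1}\otimes\tilde I_{n_y+1},\ \Delta x\Delta z\,\tilde I_{n_z+1}\otimes\tilde I_{n_x+1},\ \Delta x\Delta z\,\tilde I_{n_z+1}\otimes\tilde I_{n_x+1},\ \Delta x\Delta y\,\tilde I_{n_y+1}\otimes\tilde I_{n_x+1},\ \Delta x\Delta y\,\tilde I_{n_y+1}\otimes\tilde I_{n_x+1})$; $H_\perp=\frac{\hbar^2}{2m}L D_{\hat n}D_{S,b}''$. FDTD-Q scheme: real vectors $\psi_R^n\in\mathbb{R}^N$ and $\psi_I^{n-\frac12}\in\mathbb{R}^N$ ($n=0,\dots,n_t$), and arbitrary boundary vectors $g_R^n\in\mathbb{R}^M$, $g_I^{n+\frac12}\in\mathbb{R}^M$ ($n=0,\dots,n_t-1$), satisfying for $n=0,\dots,n_t-1$: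 $\hbar D_V''\frac{\psi_R^{n+1}-\psi_R^n}{\Delta t}=H\psi_I^{n+\frac12}-H_\perp g_I^{n+\frac12}$ and $\hbar D_V''\frac{\psi_I^{n+\frac12}-\psi_I^{n-\frac12}}{\Delta t}=-H\psi_R^n+H_\perp g_R^n$. Let $\psi^n=\begin{bmatrix}\psi_R^n\\ \psi_I^{n-\frac12}\end{bmatrix}$, $g^{n+\frac12}=\begin{bmatrix}g_R^n\\ g_I^{n+\frac12}\end{bmatrix}$, $J_1=\begin{bmatrix}0&1\\-1&0\end{bmatrix}$. Probability current: $\mathcal{I}_P^{n+\frac12}=\frac{2}{\hbar}\left(\frac{\psi^{n+1}+\psi^n}{2}\right)^T(J_1\otimes H_\perp)g^{n+\frac12}$, $n=0,\dots,n_t-1$. *)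

theory Defs
  imports "Jordan_Normal_Form.Spectral_Radius" "Jordan_Normal_Form.Gauss_Jordan_Elimination"
begin

(* Matrices are Jordan_Normal_Form matrices over real; indices are 0-based,
   so paper index i (1-based) corresponds to i-1 here. *)

definition kron :: "real mat \<Rightarrow> real mat \<Rightarrow> real mat" where
  "kron A B = mat (dim_row A * dim_row B) (dim_col A * dim_col B)
     (\<lambda>(i,j). A $$ (i div dim_row B, j div dim_col B) * B $$ (i mod dim_row B, j mod dim_col B))"

(* identity I_p *)
definition Iden :: "nat \<Rightarrow> real mat" where "Iden p = 1\<^sub>m p"

(* \tilde I_p = diag(1/2,1,...,1,1/2) *)
definition Itil :: "nat \<Rightarrow> real mat" where
  "Itil p = mat p p (\<lambda>(i,j). if i = j then (if i = 0 \<or> i = p - 1 then 1/2 else 1) else 0)"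

(* W_p = [0_{p x 1} I_p] - [I_p 0_{p x 1}], a p x (p+1) matrix *)
definition Wm :: "nat \<Rightarrow> real mat" where
  "Wm p = mat p (p+1) (\<lambda>(i,j). (if j = i + 1 then 1 else 0) - (if j = i then 1 else 0))"

(* e{p,q}: q x 1 column with 1 in (1-based) position p *)
definition ecol :: "nat \<Rightarrow> nat \<Rightarrow> real mat" where
  "ecol p q = mat q 1 (\<lambda>(i,j). if i + 1 = p then 1 else 0)"

(* horizontal concatenation [A B] *)
definition hcat2 :: "real mat \<Rightarrow> real mat \<Rightarrow> real mat" where
  "hcat2 A B = mat (dim_row A) (dim_col A + dim_col B)
     (\<lambda>(i,j). if j < dim_col A then A $$ (i,j) else B $$ (i, j - dim_col A))"

fun hcat :: "real mat list \<Rightarrow> real mat" where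
  "hcat [A] = A"
| "hcat (A # As) = hcat2 A (hcat As)"
| "hcat [] = 0\<^sub>m 0 0"

(* block diagonal diag(A_1, ..., A_k) *)
fun bdiag :: "real mat list \<Rightarrow> real mat" where
  "bdiag [] = 0\<^sub>m 0 0"
| "bdiag (A # As) = four_block_mat A (0\<^sub>m (dim_row A) (dim_col (bdiag As)))
                      (0\<^sub>m (dim_row (bdiag As)) (dim_col A)) (bdiag As)"

(* 2x2 block matrix [[A,B],[C,D]] *)
abbreviation blk2 :: "real mat \<Rightarrow> real mat \<Rightarrow> real mat \<Rightarrow> real mat \<Rightarrow> real mat" where
  "blk2 A B C D \<equiv> four_block_mat A B C D"

(* Euclidean 2-norm of a real vector *)
definition vnorm2 :: "real vec \<Rightarrow> real" where
  "vnorm2 v = sqrt (\<Sum>i<dim_vec v. (v $ i)^2)"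

(* induced (operator) 2-norm of a real matrix *)
definition mnorm2 :: "real mat \<Rightarrow> real" where
  "mnorm2 A = Sup {vnorm2 (A *\<^sub>v x) | x. x \<in> carrier_vec (dim_col A) \<and> vnorm2 x = 1}"

(* 2-norm condition number kappa(A) = ||A||_2 ||A^{-1}||_2 *)
definition cond2 :: "real mat \<Rightarrow> real" where
  "cond2 A = mnorm2 A * mnorm2 (the (mat_inverse A))"

(* spectral radius of a real square matrix (over its complex eigenvalues) *)
definition rho :: "real mat \<Rightarrow> real" where
  "rho A = spectral_radius (map_mat complex_of_real A)"

(* ---- FDTD-Q matrices ---- *)

definition Nn :: "nat \<Rightarrow> nat \<Rightarrow> nat \<Rightarrow> nat" where
  "Nn nx ny nz = (nx+1)*(ny+1)*(nz+1)"

definition DV :: "real \<Rightarrow> real \<Rightarrow> real \<Rightarrow> nat \<Rightarrow> nat \<Rightarrow> nat \<Rightarrow> real mat" where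
  "DV dx dy dz nx ny nz = (dx*dy*dz) \<cdot>\<^sub>m kron (Itil (nz+1)) (kron (Itil (ny+1)) (Itil (nx+1)))"

definition Dop :: "nat \<Rightarrow> nat \<Rightarrow> nat \<Rightarrow> real mat" where
  "Dop nx ny nz = hcat
     [ - kron (Iden (nz+1)) (kron (Iden (ny+1)) (transpose_mat (Wm nx))),
       - kron (Iden (nz+1)) (kron (transpose_mat (Wm ny)) (Iden (nx+1))),
       - kron (transpose_mat (Wm nz)) (kron (Iden (ny+1)) (Iden (nx+1))) ]"

definition DS :: "real \<Rightarrow> real \<Rightarrow> real \<Rightarrow> nat \<Rightarrow> nat \<Rightarrow> nat \<Rightarrow> real mat" where
  "DS dx dy dz nx ny nz = bdiag
     [ (dy*dz) \<cdot>\<^sub>m kron (Itil (nz+1)) (kron (Itil (ny+1)) (Iden nx)),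
       (dx*dz) \<cdot>\<^sub>m kron (Itil (nz+1)) (kron (Iden ny) (Itil (nx+1))),
       (dx*dy) \<cdot>\<^sub>m kron (Iden nz) (kron (Itil (ny+1)) (Itil (nx+1))) ]"

definition Dl :: "real \<Rightarrow> real \<Rightarrow> real \<Rightarrow> nat \<Rightarrow> nat \<Rightarrow> nat \<Rightarrow> real mat" where
  "Dl dx dy dz nx ny nz = bdiag
     [ dx \<cdot>\<^sub>m Iden (nx*(ny+1)*(nz+1)),
       dy \<cdot>\<^sub>m Iden ((nx+1)*ny*(nz+1)),
       dz \<cdot>\<^sub>m Iden ((nx+1)*(ny+1)*nz) ]"

(* D_U: diagonal matrix of the potential values U_{i,j,k} (1-based indices) in the
   node ordering i+(j-1)(nx+1)+(k-1)(nx+1)(ny+1) *)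
definition DU :: "(nat \<Rightarrow> nat \<Rightarrow> nat \<Rightarrow> real) \<Rightarrow> nat \<Rightarrow> nat \<Rightarrow> nat \<Rightarrow> real mat" where
  "DU U nx ny nz = mat_diag (Nn nx ny nz)
     (\<lambda>p. U (p mod (nx+1) + 1) ((p div (nx+1)) mod (ny+1) + 1) (p div ((nx+1)*(ny+1)) + 1))"

definition Hmat :: "real \<Rightarrow> real \<Rightarrow> real \<Rightarrow> real \<Rightarrow> real \<Rightarrow> nat \<Rightarrow> nat \<Rightarrow> nat
                    \<Rightarrow> (nat \<Rightarrow> nat \<Rightarrow> nat \<Rightarrow> real) \<Rightarrow> real mat" where
  "Hmat hbar m dx dy dz nx ny nz U =
     (hbar^2 / (2*m)) \<cdot>\<^sub>m (Dop nx ny nz * DS dx dy dz nx ny nz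
         * the (mat_inverse (Dl dx dy dz nx ny nz)) * transpose_mat (Dop nx ny nz))
     + DV dx dy dz nx ny nz * DU U nx ny nz"

definition Pmat :: "real \<Rightarrow> real \<Rightarrow> real \<Rightarrow> real \<Rightarrow> real \<Rightarrow> nat \<Rightarrow> nat \<Rightarrow> nat
                    \<Rightarrow> (nat \<Rightarrow> nat \<Rightarrow> nat \<Rightarrow> real) \<Rightarrow> real \<Rightarrow> real mat" where
  "Pmat hbar m dx dy dz nx ny nz U dt =
     (let H = Hmat hbar m dx dy dz nx ny nz U; D = DV dx dy dz nx ny nz;
          c = - dt / (2*hbar) in
      blk2 D (c \<cdot>\<^sub>m H) (c \<cdot>\<^sub>m H) D)"

(* (D_V'')^{-1/2} *)
definition DVmhalf :: "real \<Rightarrow> real \<Rightarrow> real \<Rightarrow> nat \<Rightarrow> nat \<Rightarrow> nat \<Rightarrow> real mat" where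
  "DVmhalf dx dy dz nx ny nz =
     mat_diag (Nn nx ny nz) (\<lambda>p. 1 / sqrt (DV dx dy dz nx ny nz $$ (p,p)))"

(* Delta t_{CFL,gen} = 2 / rho((1/hbar) D_V^{-1/2} H D_V^{-1/2}) *)
definition dt_cfl :: "real \<Rightarrow> real \<Rightarrow> real \<Rightarrow> real \<Rightarrow> real \<Rightarrow> nat \<Rightarrow> nat \<Rightarrow> nat
                    \<Rightarrow> (nat \<Rightarrow> nat \<Rightarrow> nat \<Rightarrow> real) \<Rightarrow> real" where
  "dt_cfl hbar m dx dy dz nx ny nz U =
     2 / rho ((1/hbar) \<cdot>\<^sub>m (DVmhalf dx dy dz nx ny nz * Hmat hbar m dx dy dz nx ny nz U
                             * DVmhalf dx dy dz nx ny nz))"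

(* boundary matrices *)
definition Lmat :: "nat \<Rightarrow> nat \<Rightarrow> nat \<Rightarrow> real mat" where
  "Lmat nx ny nz = hcat
     [ kron (Iden (nz+1)) (kron (Iden (ny+1)) (ecol 1 (nx+1))),
       kron (Iden (nz+1)) (kron (Iden (ny+1)) (ecol (nx+1) (nx+1))),
       kron (Iden (nz+1)) (kron (ecol 1 (ny+1)) (Iden (nx+1))),
       kron (Iden (nz+1)) (kron (ecol (ny+1) (ny+1)) (Iden (nx+1))),
       kron (ecol 1 (nz+1)) (kron (Iden (ny+1)) (Iden (nx+1))),
       kron (ecol (nz+1) (nz+1)) (kron (Iden (ny+1)) (Iden (nx+1))) ]"

definition Mn :: "nat \<Rightarrow> nat \<Rightarrow> nat \<Rightarrow> nat" where
  "Mn nx ny nz = dim_col (Lmat nx ny nz)"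

definition Dnhat :: "nat \<Rightarrow> nat \<Rightarrow> nat \<Rightarrow> real mat" where
  "Dnhat nx ny nz = bdiag
     [ - Iden ((ny+1)*(nz+1)), Iden ((ny+1)*(nz+1)),
       - Iden ((nx+1)*(nz+1)), Iden ((nx+1)*(nz+1)),
       - Iden ((nx+1)*(ny+1)), Iden ((nx+1)*(ny+1)) ]"

definition DSb :: "real \<Rightarrow> real \<Rightarrow> real \<Rightarrow> nat \<Rightarrow> nat \<Rightarrow> nat \<Rightarrow> real mat" where
  "DSb dx dy dz nx ny nz = bdiag
     [ (dy*dz) \<cdot>\<^sub>m kron (Itil (nz+1)) (Itil (ny+1)),
       (dy*dz) \<cdot>\<^sub>m kron (Itil (nz+1)) (Itil (ny+1)),
       (dx*dz) \<cdot>\<^sub>m kron (Itil (nz+1)) (Itil (nx+1)),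
       (dx*dz) \<cdot>\<^sub>m kron (Itil (nz+1)) (Itil (nx+1)),
       (dx*dy) \<cdot>\<^sub>m kron (Itil (ny+1)) (Itil (nx+1)),
       (dx*dy) \<cdot>\<^sub>m kron (Itil (ny+1)) (Itil (nx+1)) ]"

definition Hperp :: "real \<Rightarrow> real \<Rightarrow> real \<Rightarrow> real \<Rightarrow> real \<Rightarrow> nat \<Rightarrow> nat \<Rightarrow> nat \<Rightarrow> real mat" where
  "Hperp hbar m dx dy dz nx ny nz =
     (hbar^2 / (2*m)) \<cdot>\<^sub>m (Lmat nx ny nz * Dnhat nx ny nz * DSb dx dy dz nx ny nz)"

(* J_1 (x) A = [[0, A], [-A, 0]] *)
definition J1kron :: "real mat \<Rightarrow> real mat" where
  "J1kron A = kron (mat 2 2 (\<lambda>(i,j). if i = 0 \<and> j = 1 then 1 else if i = 1 \<and> j = 0 then -1 else 0)) A"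

end

theory Submission
  imports Defs
begin

(* The discrete energy E^n = (psi^n)^T P psi^n changes in one leapfrog step by exactly
   -dt I_P^(n+1/2), so it is conserved when the probability current vanishes.
   Below the CFL limit P is positive definite: with u = D_V^(1/2) psi_R and v = D_V^(1/2) psi_I
   its quadratic form is |u|^2 + |v|^2 - dt u^T K v for the symmetric matrix
   K = D_V^(-1/2) H D_V^(-1/2) / hbar, and |K v| <= rho(K) |v| with dt rho(K) < 2.
   For symmetric positive definite P one has |x|^2 <= ||P^-1|| x^T P x and x^T P x <= ||P|| |x|^2,
   hence |psi^n|^2 <= ||P^-1|| E^n = ||P^-1|| E^0 <= kappa(P) |psi^0|^2. *)

section \<open>Euclidean norm and Cauchy--Schwarz\<close>

lemma scalar_prod_self_nonneg: "0 \<le> (v :: real vec) \<bullet> v"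
  using conjugate_square_ge_0_vec[of v] by simp

lemma scalar_prod_self_eq_0_iff:
  "(v :: real vec) \<in> carrier_vec n \<Longrightarrow> v \<bullet> v = 0 \<longleftrightarrow> v = 0\<^sub>v n"
  using conjugate_square_eq_0_vec[of v n] by simp

lemma vnorm2_eq_sqrt_scalar_prod: "vnorm2 v = sqrt (v \<bullet> v)"
  unfolding vnorm2_def scalar_prod_def by (simp add: power2_eq_square atLeast0LessThan)

lemma vnorm2_nonneg: "0 \<le> vnorm2 v"
  by (simp add: vnorm2_eq_sqrt_scalar_prod scalar_prod_self_nonneg)

lemma power2_vnorm2: "(vnorm2 v)\<^sup>2 = v \<bullet> v"
  by (simp add: vnorm2_eq_sqrt_scalar_prod scalar_prod_self_nonneg)

lemma vnorm2_eq_0_iff: "v \<in> carrier_vec n \<Longrightarrow> vnorm2 v = 0 \<longleftrightarrow> v = 0\<^sub>v n"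
  by (simp add: vnorm2_eq_sqrt_scalar_prod scalar_prod_self_nonneg scalar_prod_self_eq_0_iff)

lemma vnorm2_pos_iff: "v \<in> carrier_vec n \<Longrightarrow> 0 < vnorm2 v \<longleftrightarrow> v \<noteq> 0\<^sub>v n"
  using vnorm2_nonneg[of v] vnorm2_eq_0_iff[of v n] by (auto simp: less_le)

lemma vnorm2_zero[simp]: "vnorm2 (0\<^sub>v n) = 0"
  by (simp add: vnorm2_def)

lemma vnorm2_smult: "vnorm2 (k \<cdot>\<^sub>v v) = \<bar>k\<bar> * vnorm2 v"
proof -
  have "(k \<cdot>\<^sub>v v) \<bullet> (k \<cdot>\<^sub>v v) = k\<^sup>2 * (v \<bullet> v)"
    unfolding scalar_prod_def by (simp add: sum_distrib_left power2_eq_square algebra_simps)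
  then show ?thesis by (simp add: vnorm2_eq_sqrt_scalar_prod real_sqrt_mult)
qed

lemma mult_mat_vec_zero_right[simp]: "A \<in> carrier_mat r c \<Longrightarrow> A *\<^sub>v 0\<^sub>v c = 0\<^sub>v r"
  by auto

lemma smult_mat_mult_vec:
  "A \<in> carrier_mat n n \<Longrightarrow> v \<in> carrier_vec n \<Longrightarrow> (c \<cdot>\<^sub>m A) *\<^sub>v v = c \<cdot>\<^sub>v (A *\<^sub>v (v :: 'a :: comm_ring_1 vec))"
  by (rule eq_vecI) (auto simp: scalar_prod_def sum_distrib_left ac_simps)

lemma transpose_smult_mat[simp]: "transpose_mat (c \<cdot>\<^sub>m A) = c \<cdot>\<^sub>m transpose_mat A"
  by (rule eq_matI) auto

lemma symmetric_mat_scalar_prod: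
  assumes "A \<in> carrier_mat n n" "transpose_mat A = A" "x \<in> carrier_vec n" "y \<in> carrier_vec n"
  shows "(A *\<^sub>v x) \<bullet> y = x \<bullet> (A *\<^sub>v (y :: real vec))"
  using transpose_vec_mult_scalar[OF assms(1,4,3)] assms(2) by simp

lemma symmetric_mat_scalar_prod_comm:
  assumes "A \<in> carrier_mat n n" "transpose_mat A = A" "x \<in> carrier_vec n" "y \<in> carrier_vec n"
  shows "x \<bullet> (A *\<^sub>v y) = y \<bullet> (A *\<^sub>v (x :: real vec))"
  using symmetric_mat_scalar_prod[OF assms(1,2,4,3)] comm_scalar_prod[of x n "A *\<^sub>v y"] assms
  by simp

lemma discriminant_le_of_quadratic_nonneg:
  fixes a b c :: real
  assumes nonneg: "\<And>t. 0 \<le> a + 2 * t * b + t\<^sup>2 * c" and "0 \<le> c"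
  shows "b\<^sup>2 \<le> a * c"
proof (cases "c = 0")
  case False
  have "0 \<le> a + 2 * (- b / c) * b + (- b / c)\<^sup>2 * c" by (rule nonneg)
  also have "\<dots> = a - b\<^sup>2 / c" using False by (simp add: field_simps power2_eq_square)
  finally show ?thesis using False \<open>0 \<le> c\<close> by (simp add: field_simps)
next
  case c0: True
  show ?thesis
  proof (rule ccontr)
    assume "\<not> b\<^sup>2 \<le> a * c"
    then have "b \<noteq> 0" using c0 by simp
    have "0 \<le> a + 2 * (- (\<bar>a\<bar> + 1) / (2 * b)) * b + (- (\<bar>a\<bar> + 1) / (2 * b))\<^sup>2 * c"
      by (rule nonneg)
    also have "\<dots> = a - (\<bar>a\<bar> + 1)" using \<open>b \<noteq> 0\<close> c0 by (simp add: field_simps)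
    finally show False by linarith
  qed
qed

lemma psd_cauchy_schwarz:
  fixes B :: "real mat"
  assumes B: "B \<in> carrier_mat n n" "transpose_mat B = B"
    and psd: "\<And>z. z \<in> carrier_vec n \<Longrightarrow> 0 \<le> (B *\<^sub>v z) \<bullet> z"
    and x: "x \<in> carrier_vec n" and y: "y \<in> carrier_vec n"
  shows "((B *\<^sub>v x) \<bullet> y)\<^sup>2 \<le> ((B *\<^sub>v x) \<bullet> x) * ((B *\<^sub>v y) \<bullet> y)"
proof (rule discriminant_le_of_quadratic_nonneg)
  fix t :: real
  have yx: "(B *\<^sub>v y) \<bullet> x = (B *\<^sub>v x) \<bullet> y"
    using symmetric_mat_scalar_prod[OF B y x] comm_scalar_prod[of y n "B *\<^sub>v x"] x y B by simp
  have "0 \<le> (B *\<^sub>v (x + t \<cdot>\<^sub>v y)) \<bullet> (x + t \<cdot>\<^sub>v y)" using psd x y by auto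
  also have "\<dots> = (B *\<^sub>v x) \<bullet> x + t * ((B *\<^sub>v x) \<bullet> y) + t * ((B *\<^sub>v y) \<bullet> x)
      + t * t * ((B *\<^sub>v y) \<bullet> y)"
    using B x y by (simp add: mult_add_distrib_mat_vec mult_mat_vec scalar_prod_add_distrib[of _ n]
        add_scalar_prod_distrib[of _ n] algebra_simps)
  finally show "0 \<le> (B *\<^sub>v x) \<bullet> x + 2 * t * ((B *\<^sub>v x) \<bullet> y) + t\<^sup>2 * ((B *\<^sub>v y) \<bullet> y)"
    unfolding yx by (simp add: power2_eq_square algebra_simps)
qed (use psd y in simp)

lemma cauchy_schwarz_vnorm2:
  assumes "x \<in> carrier_vec n" "y \<in> carrier_vec n"
  shows "\<bar>(x :: real vec) \<bullet> y\<bar> \<le> vnorm2 x * vnorm2 y"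
proof -
  have "(x \<bullet> y)\<^sup>2 \<le> (x \<bullet> x) * (y \<bullet> y)"
    using psd_cauchy_schwarz[of "1\<^sub>m n" n x y] assms by (simp add: scalar_prod_self_nonneg)
  then have "sqrt ((x \<bullet> y)\<^sup>2) \<le> sqrt ((x \<bullet> x) * (y \<bullet> y))" by (rule real_sqrt_le_mono)
  then show ?thesis by (simp add: vnorm2_eq_sqrt_scalar_prod real_sqrt_mult)
qed

lemma scalar_prod_le_vnorm2:
  "x \<in> carrier_vec n \<Longrightarrow> y \<in> carrier_vec n \<Longrightarrow> (x :: real vec) \<bullet> y \<le> vnorm2 x * vnorm2 y"
  using cauchy_schwarz_vnorm2[of x n y] by linarith

section \<open>Operator norm and condition number\<close>

lemma vnorm2_mult_mat_vec_le_frobenius: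
  fixes A :: "real mat"
  assumes A: "A \<in> carrier_mat r c" and x: "x \<in> carrier_vec c"
  shows "vnorm2 (A *\<^sub>v x) \<le> sqrt (\<Sum>i<r. row A i \<bullet> row A i) * vnorm2 x"
proof -
  have "(A *\<^sub>v x) \<bullet> (A *\<^sub>v x) = (\<Sum>i<r. (row A i \<bullet> x)\<^sup>2)"
    using A unfolding scalar_prod_def[of "A *\<^sub>v x"] by (simp add: power2_eq_square atLeast0LessThan)
  also have "\<dots> \<le> (\<Sum>i<r. (row A i \<bullet> row A i) * (x \<bullet> x))"
  proof (rule sum_mono)
    fix i assume "i \<in> {..<r}"
    have "(row A i \<bullet> x)\<^sup>2 = \<bar>row A i \<bullet> x\<bar>\<^sup>2" by simp
    also have "\<dots> \<le> (vnorm2 (row A i) * vnorm2 x)\<^sup>2"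
      by (rule power_mono) (use cauchy_schwarz_vnorm2[of "row A i" c x] A x in auto)
    finally show "(row A i \<bullet> x)\<^sup>2 \<le> (row A i \<bullet> row A i) * (x \<bullet> x)"
      by (simp add: power_mult_distrib power2_vnorm2)
  qed
  also have "\<dots> = (\<Sum>i<r. row A i \<bullet> row A i) * (x \<bullet> x)" by (simp add: sum_distrib_right)
  finally have "sqrt ((A *\<^sub>v x) \<bullet> (A *\<^sub>v x)) \<le> sqrt ((\<Sum>i<r. row A i \<bullet> row A i) * (x \<bullet> x))"
    by (rule real_sqrt_le_mono)
  then show ?thesis by (simp add: vnorm2_eq_sqrt_scalar_prod real_sqrt_mult)
qed

lemma mnorm2_bdd_above:
  "bdd_above {vnorm2 (A *\<^sub>v x) | x. x \<in> carrier_vec (dim_col A) \<and> vnorm2 x = 1}"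
proof (rule bdd_aboveI)
  fix z assume "z \<in> {vnorm2 (A *\<^sub>v x) | x. x \<in> carrier_vec (dim_col A) \<and> vnorm2 x = 1}"
  then obtain x where "x \<in> carrier_vec (dim_col A)" "vnorm2 x = 1" "z = vnorm2 (A *\<^sub>v x)" by auto
  then show "z \<le> sqrt (\<Sum>i<dim_row A. row A i \<bullet> row A i)"
    using vnorm2_mult_mat_vec_le_frobenius[of A "dim_row A" "dim_col A" x] by simp
qed

lemma vnorm2_le_mnorm2_of_unit:
  "x \<in> carrier_vec (dim_col A) \<Longrightarrow> vnorm2 x = 1 \<Longrightarrow> vnorm2 (A *\<^sub>v x) \<le> mnorm2 A"
  unfolding mnorm2_def by (rule cSup_upper[OF _ mnorm2_bdd_above]) auto

lemma vnorm2_mult_mat_vec_le_mnorm2: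
  assumes A: "A \<in> carrier_mat r c" and x: "x \<in> carrier_vec c"
  shows "vnorm2 (A *\<^sub>v x) \<le> mnorm2 A * vnorm2 x"
proof (cases "x = 0\<^sub>v c")
  case True
  then show ?thesis using A by simp
next
  case False
  then have s: "vnorm2 x > 0" using x by (simp add: vnorm2_pos_iff)
  have "vnorm2 (A *\<^sub>v ((1 / vnorm2 x) \<cdot>\<^sub>v x)) \<le> mnorm2 A"
    by (rule vnorm2_le_mnorm2_of_unit) (use A x s in \<open>auto simp: vnorm2_smult\<close>)
  also have "A *\<^sub>v ((1 / vnorm2 x) \<cdot>\<^sub>v x) = (1 / vnorm2 x) \<cdot>\<^sub>v (A *\<^sub>v x)"
    using A x by (simp add: mult_mat_vec)
  finally show ?thesis using s by (simp add: vnorm2_smult field_simps)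
qed

lemma mnorm2_nonneg:
  assumes "dim_col A > 0"
  shows "0 \<le> mnorm2 A"
proof -
  have "vnorm2 (unit_vec (dim_col A) 0 :: real vec) = 1"
    using assms unfolding vnorm2_eq_sqrt_scalar_prod by simp
  then show ?thesis
    using vnorm2_le_mnorm2_of_unit[of "unit_vec (dim_col A) 0" A] vnorm2_nonneg order_trans
    by fastforce
qed

lemma quad_form_le_mnorm2:
  assumes P: "P \<in> carrier_mat k k" and x: "x \<in> carrier_vec k"
  shows "(P *\<^sub>v x) \<bullet> x \<le> mnorm2 P * (vnorm2 x)\<^sup>2"
proof -
  have "(P *\<^sub>v x) \<bullet> x \<le> vnorm2 (P *\<^sub>v x) * vnorm2 x"
    using scalar_prod_le_vnorm2[of "P *\<^sub>v x" k x] P x by simp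
  also have "\<dots> \<le> mnorm2 P * vnorm2 x * vnorm2 x"
    by (rule mult_right_mono[OF vnorm2_mult_mat_vec_le_mnorm2[OF P x] vnorm2_nonneg])
  finally show ?thesis by (simp add: power2_eq_square mult.assoc)
qed

lemma power2_vnorm2_le_mnorm2_inverse:
  fixes P P' :: "real mat"
  assumes P: "P \<in> carrier_mat k k" "transpose_mat P = P"
    and psd: "\<And>z. z \<in> carrier_vec k \<Longrightarrow> 0 \<le> (P *\<^sub>v z) \<bullet> z"
    and inv: "P * P' = 1\<^sub>m k" "P' \<in> carrier_mat k k" and x: "x \<in> carrier_vec k"
  shows "(vnorm2 x)\<^sup>2 \<le> mnorm2 P' * ((P *\<^sub>v x) \<bullet> x)"
proof (cases "x = 0\<^sub>v k")
  case False
  define w where "w = P' *\<^sub>v x"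
  have w: "w \<in> carrier_vec k" and Pw: "P *\<^sub>v w = x"
    unfolding w_def using inv P x by (auto simp flip: assoc_mult_mat_vec)
  have "((vnorm2 x)\<^sup>2)\<^sup>2 = ((P *\<^sub>v w) \<bullet> x)\<^sup>2" by (simp add: Pw power2_vnorm2)
  also have "\<dots> \<le> ((P *\<^sub>v w) \<bullet> w) * ((P *\<^sub>v x) \<bullet> x)"
    by (rule psd_cauchy_schwarz[OF P psd w x])
  also have "\<dots> \<le> (mnorm2 P' * (vnorm2 x)\<^sup>2) * ((P *\<^sub>v x) \<bullet> x)"
  proof (rule mult_right_mono)
    have "(P *\<^sub>v w) \<bullet> w = (P' *\<^sub>v x) \<bullet> x"
      unfolding Pw using comm_scalar_prod[of x k w] w x by (simp add: w_def)
    then show "(P *\<^sub>v w) \<bullet> w \<le> mnorm2 P' * (vnorm2 x)\<^sup>2"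
      using quad_form_le_mnorm2[OF inv(2) x] by simp
  qed (rule psd[OF x])
  finally have "(vnorm2 x)\<^sup>2 * (vnorm2 x)\<^sup>2 \<le> (vnorm2 x)\<^sup>2 * (mnorm2 P' * ((P *\<^sub>v x) \<bullet> x))"
    by (simp add: power2_eq_square algebra_simps)
  moreover have "(vnorm2 x)\<^sup>2 > 0"
    using False x by (simp add: vnorm2_eq_0_iff)
  ultimately show ?thesis by (rule mult_left_le_imp_le)
qed (use P in simp)

lemma positive_definite_mat_inverse:
  fixes P :: "real mat"
  assumes P: "P \<in> carrier_mat k k"
    and pd: "\<And>z. z \<in> carrier_vec k \<Longrightarrow> z \<noteq> 0\<^sub>v k \<Longrightarrow> 0 < (P *\<^sub>v z) \<bullet> z"
  obtains P' where "mat_inverse P = Some P'" "P * P' = 1\<^sub>m k" "P' \<in> carrier_mat k k"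
proof -
  have "det P \<noteq> 0"
  proof
    assume "det P = 0"
    then obtain z where "z \<in> carrier_vec k" "z \<noteq> 0\<^sub>v k" "P *\<^sub>v z = 0\<^sub>v k"
      using det_0_iff_vec_prod_zero[OF P] by blast
    then show False using pd[of z] by simp
  qed
  then have "P \<in> Units (ring_mat TYPE(real) k ())" by (rule det_non_zero_imp_unit[OF P])
  then obtain P' where "mat_inverse P = Some P'" using mat_inverse(1)[OF P] by fastforce
  with mat_inverse(2)[OF P this] show ?thesis using that by blast
qed

lemma vnorm2_le_sqrt_cond2_mult:
  fixes P :: "real mat"
  assumes P: "P \<in> carrier_mat k k" "transpose_mat P = P"
    and pd: "\<And>z. z \<in> carrier_vec k \<Longrightarrow> z \<noteq> 0\<^sub>v k \<Longrightarrow> 0 < (P *\<^sub>v z) \<bullet> z"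
    and x: "x \<in> carrier_vec k" and y: "y \<in> carrier_vec k"
    and energy: "(P *\<^sub>v x) \<bullet> x = (P *\<^sub>v y) \<bullet> y"
  shows "vnorm2 x \<le> sqrt (cond2 P) * vnorm2 y"
proof (cases "k = 0")
  case False
  obtain P' where inv: "mat_inverse P = Some P'" "P * P' = 1\<^sub>m k" "P' \<in> carrier_mat k k"
    using positive_definite_mat_inverse[OF P(1) pd] by blast
  have psd: "0 \<le> (P *\<^sub>v z) \<bullet> z" if z: "z \<in> carrier_vec k" for z
  proof (cases "z = 0\<^sub>v k")
    case True
    then show ?thesis using P(1) by simp
  qed (use pd[OF z] in simp)
  have cond2: "0 \<le> cond2 P"
    unfolding cond2_def inv(1) using mnorm2_nonneg[of P] mnorm2_nonneg[of P'] P(1) inv(3) False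
    by simp
  have "(vnorm2 x)\<^sup>2 \<le> mnorm2 P' * ((P *\<^sub>v y) \<bullet> y)"
    using power2_vnorm2_le_mnorm2_inverse[OF P psd inv(2,3) x] energy by simp
  also have "\<dots> \<le> mnorm2 P' * (mnorm2 P * (vnorm2 y)\<^sup>2)"
    by (rule mult_left_mono[OF quad_form_le_mnorm2[OF P(1) y] mnorm2_nonneg])
      (use inv(3) False in simp)
  also have "\<dots> = (sqrt (cond2 P) * vnorm2 y)\<^sup>2"
    using cond2 by (simp add: power_mult_distrib cond2_def inv(1))
  finally show ?thesis
    by (rule power2_le_imp_le) (use cond2 vnorm2_nonneg[of y] in simp)
qed (use x y in \<open>simp add: vnorm2_def\<close>)

section \<open>Symmetric matrices and the spectral radius\<close>

lemma spectral_radius_smult_le: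
  fixes A :: "complex mat"
  assumes A: "A \<in> carrier_mat n n" and n: "n > 0" and c: "c > 0"
  shows "spectral_radius (complex_of_real c \<cdot>\<^sub>m A) \<le> c * spectral_radius A"
proof -
  let ?B = "complex_of_real c \<cdot>\<^sub>m A"
  have B: "?B \<in> carrier_mat n n" using A by simp
  from spectral_radius_mem_max(1)[OF B n] obtain \<mu> where "\<mu> \<in> spectrum ?B"
    and radius: "spectral_radius ?B = norm \<mu>" by auto
  then obtain v where v: "v \<in> carrier_vec n" "v \<noteq> 0\<^sub>v n" "?B *\<^sub>v v = \<mu> \<cdot>\<^sub>v v"
    using B unfolding spectrum_def eigenvalue_def eigenvector_def by auto
  have "A *\<^sub>v v = (1 / complex_of_real c) \<cdot>\<^sub>v (?B *\<^sub>v v)"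
    using smult_mat_mult_vec[OF A v(1)] c by (simp add: smult_smult_assoc)
  also have "\<dots> = (\<mu> / complex_of_real c) \<cdot>\<^sub>v v" using v(3) by (simp add: smult_smult_assoc)
  finally have "eigenvector A v (\<mu> / complex_of_real c)" using v A unfolding eigenvector_def by auto
  then have "norm (\<mu> / complex_of_real c) \<in> norm ` spectrum A"
    unfolding spectrum_def eigenvalue_def by auto
  from spectral_radius_mem_max(2)[OF A n this] have "norm \<mu> / c \<le> spectral_radius A"
    using c by (simp add: norm_divide)
  then show ?thesis using radius c by (simp add: field_simps)
qed

lemma rho_smult_le:
  assumes "A \<in> carrier_mat n n" "n > 0" "c > 0"
  shows "rho (c \<cdot>\<^sub>m A) \<le> c * rho A"
proof -
  have "map_mat complex_of_real (c \<cdot>\<^sub>m A) = complex_of_real c \<cdot>\<^sub>m map_mat complex_of_real A"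
    by (rule eq_matI) auto
  then show ?thesis
    unfolding rho_def using spectral_radius_smult_le[of "map_mat complex_of_real A" n c] assms by simp
qed

lemma rho_nonneg: "A \<in> carrier_mat n n \<Longrightarrow> n > 0 \<Longrightarrow> 0 \<le> rho A"
  unfolding rho_def using spectral_radius_mem_max(1)[of "map_mat complex_of_real A" n] by auto

lemma pow_mat_mult_vec_bounded:
  fixes S :: "real mat"
  assumes S: "S \<in> carrier_mat n n" and rho: "rho S < 1"
  obtains C where "\<And>k x. x \<in> carrier_vec n \<Longrightarrow> vnorm2 (S ^\<^sub>m k *\<^sub>v x) \<le> C * vnorm2 x"
proof -
  have "map_mat complex_of_real S \<in> carrier_mat n n" using S by simp
  from spectral_radius_jnf_norm_bound_less_1_upper_triangular[OF this] rho
  obtain c where c: "\<And>k. norm_bound (map_mat complex_of_real S ^\<^sub>m k) c"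
    unfolding rho_def by auto
  have entry: "((S ^\<^sub>m k) $$ (i, j))\<^sup>2 \<le> c\<^sup>2" if "i < n" "j < n" for i j k
  proof -
    have "map_mat complex_of_real (S ^\<^sub>m k) = map_mat complex_of_real S ^\<^sub>m k"
      by (rule of_real_hom.mat_hom_pow[OF S])
    with c[of k] that S have "\<bar>(S ^\<^sub>m k) $$ (i, j)\<bar> \<le> c"
      unfolding norm_bound_def by (metis carrier_matD index_map_mat norm_of_real pow_mat_dim_square)
    then show ?thesis by (metis abs_ge_zero power2_abs power_mono)
  qed
  have "vnorm2 (S ^\<^sub>m k *\<^sub>v x) \<le> sqrt (real n * (real n * c\<^sup>2)) * vnorm2 x"
    if x: "x \<in> carrier_vec n" for k x
  proof -
    have "(\<Sum>i<n. row (S ^\<^sub>m k) i \<bullet> row (S ^\<^sub>m k) i) \<le> (\<Sum>i<n. real n * c\<^sup>2)"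
    proof (rule sum_mono)
      fix i assume "i \<in> {..<n}"
      then have "row (S ^\<^sub>m k) i \<bullet> row (S ^\<^sub>m k) i = (\<Sum>j<n. ((S ^\<^sub>m k) $$ (i, j))\<^sup>2)"
        using S unfolding scalar_prod_def by (simp add: power2_eq_square atLeast0LessThan)
      also have "\<dots> \<le> (\<Sum>j<n. c\<^sup>2)" using entry \<open>i \<in> {..<n}\<close> by (intro sum_mono) auto
      finally show "row (S ^\<^sub>m k) i \<bullet> row (S ^\<^sub>m k) i \<le> real n * c\<^sup>2" by simp
    qed
    then have "sqrt (\<Sum>i<n. row (S ^\<^sub>m k) i \<bullet> row (S ^\<^sub>m k) i) \<le> sqrt (real n * (real n * c\<^sup>2))"
      by simp
    with vnorm2_mult_mat_vec_le_frobenius[of "S ^\<^sub>m k" n n x] S x vnorm2_nonneg[of x]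
    show ?thesis by (meson mult_right_mono order_trans pow_carrier_mat)
  qed
  then show ?thesis using that by blast
qed

lemma pow_mat_mult_vec_funpow:
  assumes S: "S \<in> carrier_mat n n"
  shows "x \<in> carrier_vec n \<Longrightarrow> S ^\<^sub>m k *\<^sub>v x = ((*\<^sub>v) S ^^ k) x"
proof (induction k arbitrary: x)
  case (Suc k)
  have "S ^\<^sub>m Suc k *\<^sub>v x = S ^\<^sub>m k *\<^sub>v (S *\<^sub>v x)"
    using S Suc.prems by (simp add: assoc_mult_mat_vec[of _ n n _ n])
  also have "\<dots> = ((*\<^sub>v) S ^^ k) (S *\<^sub>v x)" using S Suc by simp
  finally show ?case by (simp only: funpow_Suc_right o_apply)
qed (use S in simp)

lemma funpow_mult_mat_vec_carrier:
  "S \<in> carrier_mat n n \<Longrightarrow> x \<in> carrier_vec n \<Longrightarrow> ((*\<^sub>v) S ^^ k) x \<in> carrier_vec n"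
  by (induction k) auto

lemma symmetric_funpow_scalar_prod:
  assumes S: "S \<in> carrier_mat n n" "transpose_mat S = S"
  shows "y \<in> carrier_vec n \<Longrightarrow> z \<in> carrier_vec n
    \<Longrightarrow> (((*\<^sub>v) S ^^ k) y) \<bullet> z = y \<bullet> (((*\<^sub>v) S ^^ k) (z :: real vec))"
proof (induction k arbitrary: y)
  case (Suc k)
  have "(((*\<^sub>v) S ^^ Suc k) y) \<bullet> z = (((*\<^sub>v) S ^^ k) (S *\<^sub>v y)) \<bullet> z"
    by (simp only: funpow_Suc_right o_apply)
  also have "\<dots> = (S *\<^sub>v y) \<bullet> (((*\<^sub>v) S ^^ k) z)" using S Suc by simp
  also have "\<dots> = y \<bullet> (((*\<^sub>v) S ^^ Suc k) z)"
    using symmetric_mat_scalar_prod[OF S Suc.prems(1) funpow_mult_mat_vec_carrier[OF S(1) Suc.prems(2)]]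
    by simp
  finally show ?case .
qed simp

(* This avoids the spectral theorem: the Jordan normal form bounds the powers of S when
   rho S < 1, and symmetry gives |S y|^(2^j) <= |S^(2^j) y| for unit
   vectors y, which forces |S y| <= 1. Matrix powers acting on a vector are handled as iterates
   of the map x |-> S *v x. *)
lemma le_1_of_power_power2_bounded:
  fixes a :: real
  assumes "\<And>j. a ^ (2 ^ j) \<le> C"
  shows "a \<le> 1"
proof (rule ccontr)
  assume "\<not> a \<le> 1"
  then obtain j where "C < a ^ j" using real_arch_pow by fastforce
  also have "\<dots> \<le> a ^ (2 ^ j)" using \<open>\<not> a \<le> 1\<close> by (intro power_increasing) (auto intro: less_imp_le less_exp)
  finally show False using assms[of j] by simp
qed

lemma symmetric_vnorm2_power_power2_le:
  fixes S :: "real mat"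
  assumes S: "S \<in> carrier_mat n n" "transpose_mat S = S"
    and y: "y \<in> carrier_vec n" "vnorm2 y = 1"
  shows "vnorm2 (S *\<^sub>v y) ^ (2 ^ j) \<le> vnorm2 (((*\<^sub>v) S ^^ (2 ^ j)) y)"
proof (induction j)
  case (Suc j)
  let ?f = "(*\<^sub>v) S" and ?m = "2 ^ j :: nat"
  have fy: "(?f ^^ ?m) y \<in> carrier_vec n" "(?f ^^ (?m + ?m)) y \<in> carrier_vec n"
    using funpow_mult_mat_vec_carrier[OF S(1) y(1)] by auto
  have "vnorm2 (S *\<^sub>v y) ^ (2 ^ Suc j) = (vnorm2 (S *\<^sub>v y) ^ ?m)\<^sup>2"
    by (simp add: power_mult[symmetric] mult.commute)
  also have "\<dots> \<le> (vnorm2 ((?f ^^ ?m) y))\<^sup>2"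
    using Suc.IH by (simp add: power_mono vnorm2_nonneg)
  also have "\<dots> = y \<bullet> (?f ^^ (?m + ?m)) y"
    using symmetric_funpow_scalar_prod[OF S y(1) fy(1), of ?m]
    by (simp add: power2_vnorm2 funpow_add)
  also have "\<dots> \<le> vnorm2 ((?f ^^ (2 ^ Suc j)) y)"
    using scalar_prod_le_vnorm2[OF y(1) fy(2)] y(2) by (simp add: mult_2)
  finally show ?case .
qed simp

lemma symmetric_rho_less_1_vnorm2_le:
  fixes S :: "real mat"
  assumes S: "S \<in> carrier_mat n n" "transpose_mat S = S" and rho: "rho S < 1"
    and x: "x \<in> carrier_vec n"
  shows "vnorm2 (S *\<^sub>v x) \<le> vnorm2 x"
proof (cases "x = 0\<^sub>v n")
  case False
  obtain C where C: "\<And>k x. x \<in> carrier_vec n \<Longrightarrow> vnorm2 (S ^\<^sub>m k *\<^sub>v x) \<le> C * vnorm2 x"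
    using pow_mat_mult_vec_bounded[OF S(1) rho] by blast
  have pos: "vnorm2 x > 0" using False x by (simp add: vnorm2_pos_iff)
  define y where "y = (1 / vnorm2 x) \<cdot>\<^sub>v x"
  have y: "y \<in> carrier_vec n" "vnorm2 y = 1" using x pos by (auto simp: y_def vnorm2_smult)
  have "vnorm2 (S *\<^sub>v y) ^ (2 ^ j) \<le> C" for j
    using symmetric_vnorm2_power_power2_le[OF S y, of j] C[OF y(1), of "2 ^ j"] y
    by (simp add: pow_mat_mult_vec_funpow[OF S(1) y(1)])
  then have "vnorm2 (S *\<^sub>v y) \<le> 1" by (rule le_1_of_power_power2_bounded)
  moreover have "S *\<^sub>v y = (1 / vnorm2 x) \<cdot>\<^sub>v (S *\<^sub>v x)" using S x by (simp add: y_def mult_mat_vec)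
  ultimately show ?thesis using pos by (simp add: vnorm2_smult field_simps)
qed (use S in simp)

lemma symmetric_vnorm2_mult_mat_vec_le_rho:
  fixes S :: "real mat"
  assumes S: "S \<in> carrier_mat n n" "transpose_mat S = S" and n: "n > 0"
    and x: "x \<in> carrier_vec n"
  shows "vnorm2 (S *\<^sub>v x) \<le> rho S * vnorm2 x"
proof -
  have bound: "vnorm2 (S *\<^sub>v x) \<le> r * vnorm2 x" if r: "rho S < r" for r
  proof -
    have "r > 0" using r rho_nonneg[OF S(1) n] by simp
    have "rho ((1 / r) \<cdot>\<^sub>m S) \<le> (1 / r) * rho S" by (rule rho_smult_le[OF S(1) n]) (use \<open>r > 0\<close> in simp)
    also have "\<dots> < 1" using r \<open>r > 0\<close> by (simp add: field_simps)
    finally have "vnorm2 (((1 / r) \<cdot>\<^sub>m S) *\<^sub>v x) \<le> vnorm2 x"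
      by (intro symmetric_rho_less_1_vnorm2_le[of _ n]) (use S x in auto)
    then show ?thesis using \<open>r > 0\<close> S x by (simp add: smult_mat_mult_vec vnorm2_smult field_simps)
  qed
  show ?thesis
  proof (cases "vnorm2 x = 0")
    case True
    then show ?thesis using bound[of "rho S + 1"] by simp
  next
    case False
    then have pos: "vnorm2 x > 0" using vnorm2_nonneg[of x] by simp
    have "vnorm2 (S *\<^sub>v x) / vnorm2 x \<le> rho S"
    proof (rule dense_ge)
      fix r assume "rho S < r"
      then show "vnorm2 (S *\<^sub>v x) / vnorm2 x \<le> r" using bound pos by (simp add: pos_divide_le_eq)
    qed
    then show ?thesis using pos by (simp add: pos_divide_le_eq)
  qed
qed

section \<open>Diagonal matrices and Kronecker products\<close>

lemma mat_diag_dims[simp]: "dim_row (mat_diag n f) = n" "dim_col (mat_diag n f) = n"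
  unfolding mat_diag_def by auto

lemma mat_diag_index:
  "i < n \<Longrightarrow> j < n \<Longrightarrow> mat_diag n f $$ (i, j) = (if i = j then f i else 0)"
  unfolding mat_diag_def by auto

lemma mat_diag_cong: "(\<And>i. i < n \<Longrightarrow> f i = g i) \<Longrightarrow> mat_diag n f = mat_diag n g"
  by (rule eq_matI) (auto simp: mat_diag_index)

lemma transpose_mat_diag[simp]: "transpose_mat (mat_diag n f) = mat_diag n f"
  by (rule eq_matI) (auto simp: mat_diag_index)

lemma smult_mat_diag: "c \<cdot>\<^sub>m mat_diag n f = mat_diag n (\<lambda>i. c * f i :: real)"
  by (rule eq_matI) (auto simp: mat_diag_index)

lemma four_block_mat_diag:
  "four_block_mat (mat_diag a f) (0\<^sub>m a b) (0\<^sub>m b a) (mat_diag b g)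
     = mat_diag (a + b) (\<lambda>i. if i < a then f i else g (i - a))"
  by (rule eq_matI) (auto simp: mat_diag_index)

lemma four_block_mat_diag_empty:
  "four_block_mat (mat_diag a f) (0\<^sub>m a 0) (0\<^sub>m 0 a) (0\<^sub>m 0 0) = mat_diag a f"
  by (rule eq_matI) (auto simp: mat_diag_index)

lemma mat_diag_mult_vec:
  "v \<in> carrier_vec n \<Longrightarrow> mat_diag n f *\<^sub>v v = vec n (\<lambda>i. f i * v $ i)"
  by (rule eq_vecI) (auto simp: mat_diag_mult_left[of "mat_diag n (\<lambda>_. 1)" n n, symmetric]
      mat_diag_def scalar_prod_def sum.delta' if_distrib[where f = "\<lambda>x. x * _"] cong: if_cong)

lemma mat_diag_inverse_mult_vec:
  fixes f :: "nat \<Rightarrow> real"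
  assumes "\<And>i. i < n \<Longrightarrow> f i \<noteq> 0" and v: "v \<in> carrier_vec n"
  shows "mat_diag n (\<lambda>i. 1 / f i) *\<^sub>v (mat_diag n f *\<^sub>v v) = v"
proof -
  have "mat_diag n (\<lambda>i. 1 / f i) * mat_diag n f = 1\<^sub>m n"
    using assms(1) by (simp add: mat_diag_cong[of n _ "\<lambda>_. 1"])
  then show ?thesis using v by (simp flip: assoc_mult_mat_vec[of _ n n _ n])
qed

lemma scalar_prod_mat_diag_self:
  assumes v: "v \<in> carrier_vec n" and d: "\<And>i. i < n \<Longrightarrow> (d i :: real) \<ge> 0"
  shows "v \<bullet> (mat_diag n d *\<^sub>v v)
    = (mat_diag n (\<lambda>i. sqrt (d i)) *\<^sub>v v) \<bullet> (mat_diag n (\<lambda>i. sqrt (d i)) *\<^sub>v v)"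
  using v d by (simp add: mat_diag_mult_vec scalar_prod_def) (rule sum.cong, auto)

lemma mat_inverse_eq_Some:
  fixes A B :: "real mat"
  assumes A: "A \<in> carrier_mat n n" and B: "B \<in> carrier_mat n n"
    and AB: "A * B = 1\<^sub>m n" and BA: "B * A = 1\<^sub>m n"
  shows "mat_inverse A = Some B"
proof -
  have "A \<in> Units (ring_mat TYPE(real) n ())"
    using A B AB BA unfolding Units_def ring_mat_def by auto
  then obtain C where C: "mat_inverse A = Some C" using mat_inverse(1)[OF A] by fastforce
  then have "C * A = 1\<^sub>m n" "C \<in> carrier_mat n n" using mat_inverse(2)[OF A] by auto
  then have "C = B" using A B AB by (metis assoc_mult_mat left_mult_one_mat right_mult_one_mat)
  then show ?thesis using C by simp
qed

lemma mat_inverse_mat_diag: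
  fixes f :: "nat \<Rightarrow> real"
  assumes "\<And>i. i < n \<Longrightarrow> f i \<noteq> 0"
  shows "mat_inverse (mat_diag n f) = Some (mat_diag n (\<lambda>i. 1 / f i))"
  by (rule mat_inverse_eq_Some[of _ n]) (auto intro!: eq_matI simp: mat_diag_index assms)

lemma symmetric_sandwich:
  fixes A B :: "real mat"
  assumes A: "A \<in> carrier_mat n k" and B: "B \<in> carrier_mat k k" "transpose_mat B = B"
  shows "transpose_mat (A * B * transpose_mat A) = A * B * transpose_mat A"
proof -
  have "transpose_mat (A * B * transpose_mat A) = A * transpose_mat (A * B)"
    using transpose_mult[of "A * B" n k "transpose_mat A" n] A B by simp
  also have "\<dots> = A * (B * transpose_mat A)"
    using transpose_mult[OF A B(1)] B by simp
  also have "\<dots> = A * B * transpose_mat A"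
    using A B by (simp add: assoc_mult_mat[of _ n k _ k _ n])
  finally show ?thesis .
qed

lemma kron_dims[simp]:
  "dim_row (kron A B) = dim_row A * dim_row B" "dim_col (kron A B) = dim_col A * dim_col B"
  unfolding kron_def by auto

lemma kron_index:
  "i < dim_row A * dim_row B \<Longrightarrow> j < dim_col A * dim_col B \<Longrightarrow>
    kron A B $$ (i, j) = A $$ (i div dim_row B, j div dim_col B) * B $$ (i mod dim_row B, j mod dim_col B)"
  unfolding kron_def by auto

lemma kron_mat_diag:
  "kron (mat_diag a f) (mat_diag b g) = mat_diag (a * b) (\<lambda>i. f (i div b) * g (i mod b))"
proof (rule eq_matI)
  fix i j assume "i < dim_row (mat_diag (a * b) (\<lambda>i. f (i div b) * g (i mod b)))"
    "j < dim_col (mat_diag (a * b) (\<lambda>i. f (i div b) * g (i mod b)))"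
  then have ij: "i < a * b" "j < a * b" by auto
  then have "b > 0" by (cases b) auto
  with ij have "i div b < a" "j div b < a" "i mod b < b" "j mod b < b"
    by (auto simp: less_mult_imp_div_less)
  moreover have "i = j \<longleftrightarrow> i div b = j div b \<and> i mod b = j mod b"
    by (metis div_mult_mod_eq)
  ultimately show "kron (mat_diag a f) (mat_diag b g) $$ (i, j)
      = mat_diag (a * b) (\<lambda>i. f (i div b) * g (i mod b)) $$ (i, j)"
    using ij by (simp add: kron_index mat_diag_index)
qed auto

section \<open>The FDTD-Q matrices\<close>

lemma hcat2_dims[simp]:
  "dim_row (hcat2 A B) = dim_row A" "dim_col (hcat2 A B) = dim_col A + dim_col B"
  unfolding hcat2_def by auto

lemma bdiag_dims[simp]:
  "dim_row (bdiag As) = sum_list (map dim_row As)" "dim_col (bdiag As) = sum_list (map dim_col As)"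
  by (induction As) auto

lemma Wm_dims[simp]: "dim_row (Wm p) = p" "dim_col (Wm p) = p + 1"
  unfolding Wm_def by auto

lemma ecol_dims[simp]: "dim_row (ecol p q) = q" "dim_col (ecol p q) = 1"
  unfolding ecol_def by auto

lemma Iden_dims[simp]: "dim_row (Iden p) = p" "dim_col (Iden p) = p"
  unfolding Iden_def by auto

lemma Itil_dims[simp]: "dim_row (Itil p) = p" "dim_col (Itil p) = p"
  unfolding Itil_def by auto

lemma Itil_eq_mat_diag: "Itil p = mat_diag p (\<lambda>i. if i = 0 \<or> i = p - 1 then 1 / 2 else 1)"
  by (rule eq_matI) (auto simp: Itil_def mat_diag_index)

lemma Iden_eq_mat_diag: "Iden p = mat_diag p (\<lambda>_. 1)"
  by (simp add: Iden_def)

lemma Nn_eq: "Nn nx ny nz = (nz + 1) * ((ny + 1) * (nx + 1))"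
  unfolding Nn_def by (simp add: algebra_simps)

definition edge_count :: "nat \<Rightarrow> nat \<Rightarrow> nat \<Rightarrow> nat" where
  "edge_count nx ny nz = nx * (ny + 1) * (nz + 1) + (nx + 1) * ny * (nz + 1) + (nx + 1) * (ny + 1) * nz"

lemma DV_eq_mat_diag:
  assumes "dx > 0" "dy > 0" "dz > 0"
  obtains d where "DV dx dy dz nx ny nz = mat_diag (Nn nx ny nz) d" "\<And>i. d i > 0"
proof -
  have "\<exists>d. DV dx dy dz nx ny nz = mat_diag (Nn nx ny nz) d \<and> (\<forall>i. d i > 0)"
    unfolding DV_def Itil_eq_mat_diag kron_mat_diag smult_mat_diag Nn_eq
    using assms by (intro exI conjI refl) auto
  then show ?thesis using that by blast
qed

lemma DVmhalf_eq_mat_diag: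
  "DV dx dy dz nx ny nz = mat_diag (Nn nx ny nz) d
    \<Longrightarrow> DVmhalf dx dy dz nx ny nz = mat_diag (Nn nx ny nz) (\<lambda>p. 1 / sqrt (d p))"
  unfolding DVmhalf_def by (rule mat_diag_cong) (simp add: mat_diag_index)

lemma DS_eq_mat_diag:
  obtains f where "DS dx dy dz nx ny nz = mat_diag (edge_count nx ny nz) f"
proof -
  have "\<exists>f. DS dx dy dz nx ny nz = mat_diag ((nz + 1) * ((ny + 1) * nx)
      + ((nz + 1) * (ny * (nx + 1)) + (nz * ((ny + 1) * (nx + 1)) + 0))) f"
    unfolding DS_def Itil_eq_mat_diag Iden_eq_mat_diag kron_mat_diag smult_mat_diag
    by (simp add: four_block_mat_diag four_block_mat_diag_empty del: mat_diag_one)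
      (rule exI, rule refl)
  moreover have "(nz + 1) * ((ny + 1) * nx) + ((nz + 1) * (ny * (nx + 1)) + (nz * ((ny + 1) * (nx + 1)) + 0))
      = edge_count nx ny nz"
    unfolding edge_count_def by (simp add: algebra_simps)
  ultimately show ?thesis using that by auto
qed

lemma Dl_eq_mat_diag:
  assumes "dx > 0" "dy > 0" "dz > 0"
  obtains f where "Dl dx dy dz nx ny nz = mat_diag (edge_count nx ny nz) f" "\<And>i. f i > 0"
proof -
  have "\<exists>f. Dl dx dy dz nx ny nz = mat_diag (edge_count nx ny nz) f \<and> (\<forall>i. f i > 0)"
    unfolding Dl_def Iden_eq_mat_diag smult_mat_diag edge_count_def using assms
    by (simp add: four_block_mat_diag four_block_mat_diag_empty add.assoc del: mat_diag_one)
      (intro exI conjI refl, auto)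
  then show ?thesis using that by blast
qed

lemma Dop_carrier: "Dop nx ny nz \<in> carrier_mat (Nn nx ny nz) (edge_count nx ny nz)"
proof -
  have "dim_row (Dop nx ny nz) = (nz + 1) * ((ny + 1) * (nx + 1))"
    "dim_col (Dop nx ny nz) = (nz + 1) * ((ny + 1) * nx) + ((nz + 1) * (ny * (nx + 1)) + nz * ((ny + 1) * (nx + 1)))"
    by (simp_all add: Dop_def)
  then show ?thesis unfolding carrier_mat_def Nn_eq edge_count_def by (simp add: ac_simps)
qed

lemma Hmat_carrier_symmetric:
  assumes "dx > 0" "dy > 0" "dz > 0"
  shows "Hmat hbar m dx dy dz nx ny nz U \<in> carrier_mat (Nn nx ny nz) (Nn nx ny nz)"
    and "transpose_mat (Hmat hbar m dx dy dz nx ny nz U) = Hmat hbar m dx dy dz nx ny nz U"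
proof -
  let ?N = "Nn nx ny nz" and ?K = "edge_count nx ny nz" and ?A = "Dop nx ny nz"
  obtain fS where fS: "DS dx dy dz nx ny nz = mat_diag ?K fS" by (rule DS_eq_mat_diag)
  obtain fl where fl: "Dl dx dy dz nx ny nz = mat_diag ?K fl" "\<And>i. fl i > 0"
    using Dl_eq_mat_diag assms by blast
  obtain d where d: "DV dx dy dz nx ny nz = mat_diag ?N d" using DV_eq_mat_diag assms by blast
  define B where "B = mat_diag ?K (\<lambda>i. fS i * (1 / fl i))"
  define V where "V = mat_diag ?N (\<lambda>p. d p * U (p mod (nx + 1) + 1) ((p div (nx + 1)) mod (ny + 1) + 1)
      (p div ((nx + 1) * (ny + 1)) + 1))"
  have "the (mat_inverse (Dl dx dy dz nx ny nz)) = mat_diag ?K (\<lambda>i. 1 / fl i)"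
    unfolding fl(1) using mat_inverse_mat_diag[of ?K fl] fl(2) by (simp add: less_imp_neq[symmetric])
  then have H: "Hmat hbar m dx dy dz nx ny nz U = (hbar\<^sup>2 / (2 * m)) \<cdot>\<^sub>m (?A * B * transpose_mat ?A) + V"
    unfolding Hmat_def fS d DU_def B_def V_def
    using Dop_carrier by (simp add: assoc_mult_mat[of _ ?N ?K _ ?K _ ?K])
  have AB: "?A * B * transpose_mat ?A \<in> carrier_mat ?N ?N"
    unfolding B_def using Dop_carrier
    by (intro mult_carrier_mat[of _ ?N ?K]) (simp_all add: mult_carrier_mat[of _ ?N ?K])
  show "Hmat hbar m dx dy dz nx ny nz U \<in> carrier_mat ?N ?N" unfolding H V_def using AB by simp
  show "transpose_mat (Hmat hbar m dx dy dz nx ny nz U) = Hmat hbar m dx dy dz nx ny nz U"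
    unfolding H using AB symmetric_sandwich[OF Dop_carrier, of B] B_def V_def
    by (simp add: transpose_add[of _ ?N ?N])
qed

lemma Hperp_carrier: "Hperp hbar m dx dy dz nx ny nz \<in> carrier_mat (Nn nx ny nz) (Mn nx ny nz)"
proof -
  have "dim_row (Hperp hbar m dx dy dz nx ny nz) = (nz + 1) * ((ny + 1) * (nx + 1))"
    "dim_col (Hperp hbar m dx dy dz nx ny nz) = dim_col (DSb dx dy dz nx ny nz)"
    "dim_col (DSb dx dy dz nx ny nz) = dim_col (Lmat nx ny nz)"
    by (simp_all add: Hperp_def Lmat_def DSb_def ac_simps)
  then show ?thesis unfolding carrier_mat_def Mn_def Nn_eq by simp
qed

lemma J1kron_eq_four_block_mat:
  assumes A: "A \<in> carrier_mat r c"
  shows "J1kron A = four_block_mat (0\<^sub>m r c) A (- A) (0\<^sub>m r c)"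
proof (rule eq_matI)
  fix i j assume "i < dim_row (four_block_mat (0\<^sub>m r c) A (- A) (0\<^sub>m r c))"
    "j < dim_col (four_block_mat (0\<^sub>m r c) A (- A) (0\<^sub>m r c))"
  then have ij: "i < 2 * r" "j < 2 * c" using A by auto
  have "(i < r \<longrightarrow> i div r = 0 \<and> i mod r = i) \<and> (\<not> i < r \<longrightarrow> i div r = 1 \<and> i mod r = i - r)"
    "(j < c \<longrightarrow> j div c = 0 \<and> j mod c = j) \<and> (\<not> j < c \<longrightarrow> j div c = 1 \<and> j mod c = j - c)"
    using ij by (auto simp: div_eq_0_iff le_div_geq le_mod_geq)
  then show "J1kron A $$ (i, j) = four_block_mat (0\<^sub>m r c) A (- A) (0\<^sub>m r c) $$ (i, j)"
    unfolding J1kron_def using A ij by (subst kron_index) auto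
qed (use A in \<open>auto simp: J1kron_def\<close>)

lemma J1kron_mult_append:
  assumes A: "A \<in> carrier_mat r c" and x: "x \<in> carrier_vec c" and y: "y \<in> carrier_vec c"
  shows "J1kron A *\<^sub>v (x @\<^sub>v y) = (A *\<^sub>v y) @\<^sub>v (- (A *\<^sub>v (x :: real vec)))"
proof -
  have "J1kron A *\<^sub>v (x @\<^sub>v y) = (0\<^sub>m r c *\<^sub>v x + A *\<^sub>v y) @\<^sub>v ((- A) *\<^sub>v x + 0\<^sub>m r c *\<^sub>v y)"
    unfolding J1kron_eq_four_block_mat[OF A]
    by (rule four_block_mat_mult_vec[OF _ A _ _ x y]) (use A in auto)
  also have "0\<^sub>m r c *\<^sub>v x + A *\<^sub>v y = A *\<^sub>v y" using A x y by auto
  also have "(- A) *\<^sub>v x + 0\<^sub>m r c *\<^sub>v y = - (A *\<^sub>v x)"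
    by (rule eq_vecI) (use A x y in \<open>auto simp: scalar_prod_def sum_negf\<close>)
  finally show ?thesis .
qed

section \<open>Discrete energy\<close>

definition fdtd_energy_mat :: "real mat \<Rightarrow> real mat \<Rightarrow> real \<Rightarrow> real \<Rightarrow> real mat" where
  "fdtd_energy_mat D H hbar dt =
     four_block_mat D ((- dt / (2 * hbar)) \<cdot>\<^sub>m H) ((- dt / (2 * hbar)) \<cdot>\<^sub>m H) D"

definition probability_current :: "real \<Rightarrow> real mat \<Rightarrow> real vec \<Rightarrow> real vec \<Rightarrow> real vec \<Rightarrow> real" where
  "probability_current hbar Hp \<psi>' \<psi> g = (2 / hbar) * (((1 / 2) \<cdot>\<^sub>v (\<psi>' + \<psi>)) \<bullet> (J1kron Hp *\<^sub>v g))"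

lemma fdtd_energy_mat_carrier_symmetric:
  assumes D: "D \<in> carrier_mat n n" "transpose_mat D = D" and H: "H \<in> carrier_mat n n" "transpose_mat H = H"
  shows "fdtd_energy_mat D H hbar dt \<in> carrier_mat (n + n) (n + n)"
    and "transpose_mat (fdtd_energy_mat D H hbar dt) = fdtd_energy_mat D H hbar dt"
  using D H transpose_four_block_mat[OF D(1) smult_carrier_mat[OF H(1)] smult_carrier_mat[OF H(1)] D(1)]
  unfolding fdtd_energy_mat_def by auto

lemma fdtd_energy_mat_quad_form:
  assumes D: "D \<in> carrier_mat n n" and H: "H \<in> carrier_mat n n" "transpose_mat H = H"
    and R: "R \<in> carrier_vec n" and I: "I \<in> carrier_vec n"
  shows "(fdtd_energy_mat D H hbar dt *\<^sub>v (R @\<^sub>v I)) \<bullet> (R @\<^sub>v I)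
    = R \<bullet> (D *\<^sub>v R) + I \<bullet> (D *\<^sub>v I) - dt / hbar * (R \<bullet> (H *\<^sub>v I))"
proof -
  let ?c = "- dt / (2 * hbar)"
  have cH: "?c \<cdot>\<^sub>m H \<in> carrier_mat n n" using H by simp
  have "(fdtd_energy_mat D H hbar dt *\<^sub>v (R @\<^sub>v I)) \<bullet> (R @\<^sub>v I)
      = (D *\<^sub>v R + (?c \<cdot>\<^sub>m H) *\<^sub>v I) \<bullet> R + ((?c \<cdot>\<^sub>m H) *\<^sub>v R + D *\<^sub>v I) \<bullet> I"
    unfolding fdtd_energy_mat_def four_block_mat_mult_vec[OF D cH cH D R I]
    using D cH R I by (intro scalar_prod_append) auto
  also have "\<dots> = R \<bullet> (D *\<^sub>v R) + I \<bullet> (D *\<^sub>v I) + ?c * ((H *\<^sub>v I) \<bullet> R + (H *\<^sub>v R) \<bullet> I)"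
    using D H R I comm_scalar_prod[of "D *\<^sub>v R" n R] comm_scalar_prod[of "D *\<^sub>v I" n I]
    by (simp add: smult_mat_mult_vec[of _ n] add_scalar_prod_distrib[of _ n] algebra_simps)
  also have "(H *\<^sub>v I) \<bullet> R + (H *\<^sub>v R) \<bullet> I = 2 * (R \<bullet> (H *\<^sub>v I))"
    using symmetric_mat_scalar_prod[OF H R I] symmetric_mat_scalar_prod_comm[OF H I R]
      symmetric_mat_scalar_prod[OF H I R] by simp
  finally show ?thesis by (simp add: field_simps)
qed

lemma probability_current_append:
  assumes Hp: "Hp \<in> carrier_mat n k"
    and v: "R' \<in> carrier_vec n" "R \<in> carrier_vec n" "I' \<in> carrier_vec n" "I \<in> carrier_vec n"
    and g: "gR \<in> carrier_vec k" "gI \<in> carrier_vec k"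
  shows "probability_current hbar Hp (R' @\<^sub>v I') (R @\<^sub>v I) (gR @\<^sub>v gI)
    = ((R' + R) \<bullet> (Hp *\<^sub>v gI) - (I' + I) \<bullet> (Hp *\<^sub>v gR)) / hbar"
proof -
  have "(R' @\<^sub>v I') + (R @\<^sub>v I) = (R' + R) @\<^sub>v (I' + I)" using v by (rule append_vec_add)
  moreover have "((R' + R) @\<^sub>v (I' + I)) \<bullet> ((Hp *\<^sub>v gI) @\<^sub>v - (Hp *\<^sub>v gR))
      = (R' + R) \<bullet> (Hp *\<^sub>v gI) - (I' + I) \<bullet> (Hp *\<^sub>v gR)"
    using Hp v g by (subst scalar_prod_append[of _ n _ n]) auto
  ultimately have "probability_current hbar Hp (R' @\<^sub>v I') (R @\<^sub>v I) (gR @\<^sub>v gI)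
      = (2 / hbar) * ((1 / 2) * ((R' + R) \<bullet> (Hp *\<^sub>v gI) - (I' + I) \<bullet> (Hp *\<^sub>v gR)))"
    unfolding probability_current_def J1kron_mult_append[OF Hp g]
    using Hp v g by (subst smult_scalar_prod_distrib[of _ "n + n"]) (auto simp flip: append_vec_add)
  then show ?thesis by (cases "hbar = 0") (simp_all add: field_simps)
qed

lemma leapfrog_scalar_prod_difference:
  fixes D :: "real mat"
  assumes D: "D \<in> carrier_mat n n" "transpose_mat D = D"
    and x: "x \<in> carrier_vec n" "x' \<in> carrier_vec n" and "hbar \<noteq> 0" "dt \<noteq> 0"
    and scheme: "hbar \<cdot>\<^sub>v (D *\<^sub>v ((1 / dt) \<cdot>\<^sub>v (x' - x))) = w"
  shows "x' \<bullet> (D *\<^sub>v x') - x \<bullet> (D *\<^sub>v x) = dt / hbar * ((x' + x) \<bullet> w)"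
proof -
  have "(x' + x) \<bullet> (D *\<^sub>v (x' - x)) = x' \<bullet> (D *\<^sub>v x') - x \<bullet> (D *\<^sub>v x)"
    using D x symmetric_mat_scalar_prod_comm[OF D x]
    by (simp add: mult_minus_distrib_mat_vec add_scalar_prod_distrib[of _ n]
        scalar_prod_minus_distrib[of _ n] algebra_simps)
  moreover have "(x' + x) \<bullet> w = hbar / dt * ((x' + x) \<bullet> (D *\<^sub>v (x' - x)))"
    using D x unfolding scheme[symmetric] by (simp add: mult_mat_vec)
  ultimately show ?thesis using \<open>hbar \<noteq> 0\<close> \<open>dt \<noteq> 0\<close> by simp
qed

lemma fdtd_energy_step:
  fixes D H Hp :: "real mat"
  assumes D: "D \<in> carrier_mat n n" "transpose_mat D = D"
    and H: "H \<in> carrier_mat n n" "transpose_mat H = H" and Hp: "Hp \<in> carrier_mat n k"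
    and v: "R' \<in> carrier_vec n" "R \<in> carrier_vec n" "I' \<in> carrier_vec n" "I \<in> carrier_vec n"
    and g: "gR \<in> carrier_vec k" "gI \<in> carrier_vec k"
    and nonzero: "hbar \<noteq> 0" "dt \<noteq> 0"
    and schemeR: "hbar \<cdot>\<^sub>v (D *\<^sub>v ((1 / dt) \<cdot>\<^sub>v (R' - R))) = H *\<^sub>v I' - Hp *\<^sub>v gI"
    and schemeI: "hbar \<cdot>\<^sub>v (D *\<^sub>v ((1 / dt) \<cdot>\<^sub>v (I' - I))) = - (H *\<^sub>v R) + Hp *\<^sub>v gR"
  shows "(fdtd_energy_mat D H hbar dt *\<^sub>v (R' @\<^sub>v I')) \<bullet> (R' @\<^sub>v I')
       - (fdtd_energy_mat D H hbar dt *\<^sub>v (R @\<^sub>v I)) \<bullet> (R @\<^sub>v I)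
     = - dt * probability_current hbar Hp (R' @\<^sub>v I') (R @\<^sub>v I) (gR @\<^sub>v gI)"
proof -
  have u: "Hp *\<^sub>v gR \<in> carrier_vec n" "Hp *\<^sub>v gI \<in> carrier_vec n" using Hp g by auto
  have "R' \<bullet> (D *\<^sub>v R') - R \<bullet> (D *\<^sub>v R) = dt / hbar * ((R' + R) \<bullet> (H *\<^sub>v I' - Hp *\<^sub>v gI))"
    by (rule leapfrog_scalar_prod_difference[OF D v(2,1) nonzero schemeR])
  also have "\<dots> = dt / hbar * (R' \<bullet> (H *\<^sub>v I') + R \<bullet> (H *\<^sub>v I') - (R' + R) \<bullet> (Hp *\<^sub>v gI))"
    using H v u by (simp add: add_scalar_prod_distrib[of _ n] scalar_prod_minus_distrib[of _ n])
  finally have dR: "R' \<bullet> (D *\<^sub>v R') - R \<bullet> (D *\<^sub>v R)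
      = dt / hbar * (R' \<bullet> (H *\<^sub>v I') + R \<bullet> (H *\<^sub>v I') - (R' + R) \<bullet> (Hp *\<^sub>v gI))" .
  have "I' \<bullet> (D *\<^sub>v I') - I \<bullet> (D *\<^sub>v I) = dt / hbar * ((I' + I) \<bullet> (- (H *\<^sub>v R) + Hp *\<^sub>v gR))"
    by (rule leapfrog_scalar_prod_difference[OF D v(4,3) nonzero schemeI])
  also have "\<dots> = dt / hbar * (- (R \<bullet> (H *\<^sub>v I')) - R \<bullet> (H *\<^sub>v I) + (I' + I) \<bullet> (Hp *\<^sub>v gR))"
    using H v u symmetric_mat_scalar_prod_comm[OF H v(3,2)] symmetric_mat_scalar_prod_comm[OF H v(4,2)]
    by (simp add: add_scalar_prod_distrib[of _ n] scalar_prod_add_distrib[of _ n])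
  finally have dI: "I' \<bullet> (D *\<^sub>v I') - I \<bullet> (D *\<^sub>v I)
      = dt / hbar * (- (R \<bullet> (H *\<^sub>v I')) - R \<bullet> (H *\<^sub>v I) + (I' + I) \<bullet> (Hp *\<^sub>v gR))" .
  define a where "a = dt / hbar"
  have "- dt * probability_current hbar Hp (R' @\<^sub>v I') (R @\<^sub>v I) (gR @\<^sub>v gI)
      = - a * ((R' + R) \<bullet> (Hp *\<^sub>v gI) - (I' + I) \<bullet> (Hp *\<^sub>v gR))"
    unfolding probability_current_append[OF Hp v g] a_def by simp
  then show ?thesis
    unfolding fdtd_energy_mat_quad_form[OF D(1) H v(1,3)] fdtd_energy_mat_quad_form[OF D(1) H v(2,4)]
    using dR dI unfolding a_def[symmetric] by (simp add: algebra_simps)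
qed

lemma fdtd_energy_conserved:
  fixes D H Hp :: "real mat" and psiR psiI gR gI :: "nat \<Rightarrow> real vec"
  assumes D: "D \<in> carrier_mat n n" "transpose_mat D = D"
    and H: "H \<in> carrier_mat n n" "transpose_mat H = H" and Hp: "Hp \<in> carrier_mat n k"
    and nonzero: "hbar \<noteq> 0" "dt \<noteq> 0"
    and dimR: "\<And>j. j \<le> nt \<Longrightarrow> psiR j \<in> carrier_vec n"
    and dimI: "\<And>j. j \<le> nt \<Longrightarrow> psiI j \<in> carrier_vec n"
    and dimgR: "\<And>j. j < nt \<Longrightarrow> gR j \<in> carrier_vec k"
    and dimgI: "\<And>j. j < nt \<Longrightarrow> gI j \<in> carrier_vec k"
    and schemeR: "\<And>j. j < nt \<Longrightarrow>
       hbar \<cdot>\<^sub>v (D *\<^sub>v ((1 / dt) \<cdot>\<^sub>v (psiR (Suc j) - psiR j))) = H *\<^sub>v psiI (Suc j) - Hp *\<^sub>v gI j"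
    and schemeI: "\<And>j. j < nt \<Longrightarrow>
       hbar \<cdot>\<^sub>v (D *\<^sub>v ((1 / dt) \<cdot>\<^sub>v (psiI (Suc j) - psiI j))) = - (H *\<^sub>v psiR j) + Hp *\<^sub>v gR j"
    and current: "\<And>j. j < nt \<Longrightarrow> probability_current hbar Hp
       (psiR (Suc j) @\<^sub>v psiI (Suc j)) (psiR j @\<^sub>v psiI j) (gR j @\<^sub>v gI j) = 0"
    and j: "j \<le> nt"
  shows "(fdtd_energy_mat D H hbar dt *\<^sub>v (psiR j @\<^sub>v psiI j)) \<bullet> (psiR j @\<^sub>v psiI j)
    = (fdtd_energy_mat D H hbar dt *\<^sub>v (psiR 0 @\<^sub>v psiI 0)) \<bullet> (psiR 0 @\<^sub>v psiI 0)"
  using j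
proof (induction j)
  case (Suc j)
  then have "j < nt" by simp
  with fdtd_energy_step[OF D H Hp dimR dimR dimI dimI dimgR dimgI nonzero schemeR schemeI] current Suc
  show ?case by simp
qed simp

lemma fdtd_energy_mat_quad_form_scaled:
  fixes H :: "real mat" and d :: "nat \<Rightarrow> real"
  assumes d: "\<And>i. i < n \<Longrightarrow> d i > 0" and H: "H \<in> carrier_mat n n" "transpose_mat H = H"
    and hbar: "hbar \<noteq> 0" and R: "R \<in> carrier_vec n" and I: "I \<in> carrier_vec n"
  defines "Dm \<equiv> mat_diag n (\<lambda>i. 1 / sqrt (d i))" and "Dh \<equiv> mat_diag n (\<lambda>i. sqrt (d i))"
  shows "(fdtd_energy_mat (mat_diag n d) H hbar dt *\<^sub>v (R @\<^sub>v I)) \<bullet> (R @\<^sub>v I)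
    = (vnorm2 (Dh *\<^sub>v R))\<^sup>2 + (vnorm2 (Dh *\<^sub>v I))\<^sup>2
      - dt * ((Dh *\<^sub>v R) \<bullet> (((1 / hbar) \<cdot>\<^sub>m (Dm * H * Dm)) *\<^sub>v (Dh *\<^sub>v I)))"
proof -
  define u v where "u = Dh *\<^sub>v R" and "v = Dh *\<^sub>v I"
  have Dm: "Dm \<in> carrier_mat n n" "transpose_mat Dm = Dm" by (simp_all add: Dm_def)
  have uv: "u \<in> carrier_vec n" "v \<in> carrier_vec n"
    unfolding u_def v_def Dh_def using R I by (auto intro: mult_mat_vec_carrier[OF mat_diag_dim])
  have RI_eq: "R = Dm *\<^sub>v u" "I = Dm *\<^sub>v v"
    using mat_diag_inverse_mult_vec[of n "\<lambda>i. sqrt (d i)"] d R I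
    by (simp_all add: u_def v_def Dm_def Dh_def less_imp_neq[symmetric])
  have "R \<bullet> (H *\<^sub>v I) = u \<bullet> (Dm *\<^sub>v (H *\<^sub>v (Dm *\<^sub>v v)))"
    unfolding RI_eq using symmetric_mat_scalar_prod[OF Dm uv(1)] H uv Dm by simp
  also have "\<dots> = hbar * (u \<bullet> (((1 / hbar) \<cdot>\<^sub>m (Dm * H * Dm)) *\<^sub>v v))"
    using H uv Dm hbar by (simp add: smult_mat_mult_vec[of _ n] assoc_mult_mat_vec[of _ n n _ n])
  finally show ?thesis
    using fdtd_energy_mat_quad_form[OF _ H R I] scalar_prod_mat_diag_self[OF R]
      scalar_prod_mat_diag_self[OF I] d hbar
    by (simp add: power2_vnorm2 u_def v_def Dh_def less_imp_le)
qed

lemma fdtd_energy_mat_positive_definite: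
  fixes H :: "real mat" and d :: "nat \<Rightarrow> real"
  assumes n: "n > 0" and d: "\<And>i. i < n \<Longrightarrow> d i > 0"
    and H: "H \<in> carrier_mat n n" "transpose_mat H = H" and hbar: "hbar > 0" and dt: "dt > 0"
    and cfl: "dt < 2 / rho ((1 / hbar) \<cdot>\<^sub>m
        (mat_diag n (\<lambda>i. 1 / sqrt (d i)) * H * mat_diag n (\<lambda>i. 1 / sqrt (d i))))"
    and z: "z \<in> carrier_vec (n + n)" "z \<noteq> 0\<^sub>v (n + n)"
  shows "0 < (fdtd_energy_mat (mat_diag n d) H hbar dt *\<^sub>v z) \<bullet> z"
proof -
  define Dm where "Dm = mat_diag n (\<lambda>i. 1 / sqrt (d i))"
  define Dh where "Dh = mat_diag n (\<lambda>i. sqrt (d i))"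
  define K where "K = (1 / hbar) \<cdot>\<^sub>m (Dm * H * Dm)"
  have Dm: "Dm \<in> carrier_mat n n" "transpose_mat Dm = Dm" by (simp_all add: Dm_def)
  have K: "K \<in> carrier_mat n n" "transpose_mat K = K"
    using symmetric_sandwich[OF Dm(1) H] Dm H by (simp_all add: K_def)
  have "dt * rho K < 2"
    using cfl dt rho_nonneg[OF K(1) n] unfolding K_def[symmetric] Dm_def[symmetric]
    by (cases "rho K = 0") (simp_all add: pos_less_divide_eq)
  obtain R I where RI: "R \<in> carrier_vec n" "I \<in> carrier_vec n" "z = R @\<^sub>v I"
    using z(1) by (metis carrier_vec_def mem_Collect_eq vec_first_last_append vec_first_carrier vec_last_carrier)
  define u v where "u = Dh *\<^sub>v R" and "v = Dh *\<^sub>v I"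
  have uv: "u \<in> carrier_vec n" "v \<in> carrier_vec n"
    unfolding u_def v_def Dh_def using RI by (auto intro: mult_mat_vec_carrier[OF mat_diag_dim])
  have "u \<bullet> (K *\<^sub>v v) \<le> vnorm2 u * vnorm2 (K *\<^sub>v v)"
    using scalar_prod_le_vnorm2[of u n "K *\<^sub>v v"] uv K by simp
  also have "\<dots> \<le> vnorm2 u * (rho K * vnorm2 v)"
    by (rule mult_left_mono[OF symmetric_vnorm2_mult_mat_vec_le_rho[OF K n uv(2)] vnorm2_nonneg])
  also have "\<dots> = rho K * (vnorm2 u * vnorm2 v)" by (simp add: ac_simps)
  also have "\<dots> \<le> rho K * (((vnorm2 u)\<^sup>2 + (vnorm2 v)\<^sup>2) / 2)"
    by (rule mult_left_mono) (use sum_squares_bound[of "vnorm2 u" "vnorm2 v"] rho_nonneg[OF K(1) n] in auto)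
  finally have cross: "dt * (u \<bullet> (K *\<^sub>v v)) \<le> dt * (rho K * (((vnorm2 u)\<^sup>2 + (vnorm2 v)\<^sup>2) / 2))"
    using dt by simp
  have "R = Dm *\<^sub>v u" "I = Dm *\<^sub>v v"
    using mat_diag_inverse_mult_vec[of n "\<lambda>i. sqrt (d i)"] d RI
    by (simp_all add: u_def v_def Dm_def Dh_def less_imp_neq[symmetric])
  then have "u \<noteq> 0\<^sub>v n \<or> v \<noteq> 0\<^sub>v n" using z(2) RI(3) Dm by auto
  then have pos: "0 < (vnorm2 u)\<^sup>2 + (vnorm2 v)\<^sup>2"
    using uv by (auto intro: add_pos_nonneg add_nonneg_pos simp: vnorm2_eq_0_iff)
  have "dt * (rho K * (((vnorm2 u)\<^sup>2 + (vnorm2 v)\<^sup>2) / 2)) < (vnorm2 u)\<^sup>2 + (vnorm2 v)\<^sup>2"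
    using mult_strict_right_mono[OF \<open>dt * rho K < 2\<close> pos] by (simp add: field_simps)
  then show ?thesis
    using fdtd_energy_mat_quad_form_scaled[OF d H _ RI(1,2), where dt = dt] hbar cross
    unfolding RI(3) u_def v_def Dh_def K_def Dm_def by simp
qed

lemma Pmat_eq_fdtd_energy_mat:
  "Pmat hbar m dx dy dz nx ny nz U dt
    = fdtd_energy_mat (DV dx dy dz nx ny nz) (Hmat hbar m dx dy dz nx ny nz U) hbar dt"
  unfolding Pmat_def fdtd_energy_mat_def Let_def ..

lemma Pmat_positive_definite:
  assumes "dx > 0" "dy > 0" "dz > 0" "hbar > 0" "dt > 0"
    and cfl: "dt < dt_cfl hbar m dx dy dz nx ny nz U"
    and z: "z \<in> carrier_vec (Nn nx ny nz + Nn nx ny nz)" "z \<noteq> 0\<^sub>v (Nn nx ny nz + Nn nx ny nz)"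
  shows "0 < (Pmat hbar m dx dy dz nx ny nz U dt *\<^sub>v z) \<bullet> z"
proof -
  obtain d where DV: "DV dx dy dz nx ny nz = mat_diag (Nn nx ny nz) d" and d: "\<And>i. d i > 0"
    using DV_eq_mat_diag assms(1-3) by blast
  show ?thesis
    unfolding Pmat_eq_fdtd_energy_mat DV
  proof (rule fdtd_energy_mat_positive_definite[OF _ d Hmat_carrier_symmetric[OF assms(1-3)] assms(4,5) _ z])
    show "Nn nx ny nz > 0" by (simp add: Nn_def)
    show "dt < 2 / rho ((1 / hbar) \<cdot>\<^sub>m (mat_diag (Nn nx ny nz) (\<lambda>i. 1 / sqrt (d i))
        * Hmat hbar m dx dy dz nx ny nz U * mat_diag (Nn nx ny nz) (\<lambda>i. 1 / sqrt (d i))))"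
      using cfl DVmhalf_eq_mat_diag[OF DV] unfolding dt_cfl_def by simp
  qed
qed

(* psiR n = psi_R^n, psiI n = psi_I^{n-1/2}, gR n = g_R^n, gI n = g_I^{n+1/2} *)
theorem lemma3:
  fixes hbar m dx dy dz dt :: real
    and nx ny nz nt :: nat
    and U :: "nat \<Rightarrow> nat \<Rightarrow> nat \<Rightarrow> real"
    and psiR psiI gR gI :: "nat \<Rightarrow> real vec"
  defines "N \<equiv> Nn nx ny nz"
    and "M \<equiv> Mn nx ny nz"
    and "H \<equiv> Hmat hbar m dx dy dz nx ny nz U"
    and "DVm \<equiv> DV dx dy dz nx ny nz"
    and "Hp \<equiv> Hperp hbar m dx dy dz nx ny nz"
    and "psi \<equiv> (\<lambda>n. psiR n @\<^sub>v psiI n)"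
    and "g \<equiv> (\<lambda>n. gR n @\<^sub>v gI n)"
  assumes hbar: "hbar > 0" and mpos: "m > 0"
    and dxpos: "dx > 0" and dypos: "dy > 0" and dzpos: "dz > 0"
    and nxpos: "nx > 0" and nypos: "ny > 0" and nzpos: "nz > 0" and ntpos: "nt > 0"
    and dtpos: "dt > 0"
    and cfl: "dt < dt_cfl hbar m dx dy dz nx ny nz U"
    and dimR: "\<And>n. n \<le> nt \<Longrightarrow> psiR n \<in> carrier_vec N"
    and dimI: "\<And>n. n \<le> nt \<Longrightarrow> psiI n \<in> carrier_vec N"
    and dimgR: "\<And>n. n < nt \<Longrightarrow> gR n \<in> carrier_vec M"
    and dimgI: "\<And>n. n < nt \<Longrightarrow> gI n \<in> carrier_vec M"
    and schemeR: "\<And>n. n < nt \<Longrightarrow>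
       hbar \<cdot>\<^sub>v (DVm *\<^sub>v ((1/dt) \<cdot>\<^sub>v (psiR (Suc n) - psiR n)))
         = H *\<^sub>v psiI (Suc n) - Hp *\<^sub>v gI n"
    and schemeI: "\<And>n. n < nt \<Longrightarrow>
       hbar \<cdot>\<^sub>v (DVm *\<^sub>v ((1/dt) \<cdot>\<^sub>v (psiI (Suc n) - psiI n)))
         = - (H *\<^sub>v psiR n) + Hp *\<^sub>v gR n"
    and current: "\<And>n. n < nt \<Longrightarrow>
       (2/hbar) * (((1/2) \<cdot>\<^sub>v (psi (Suc n) + psi n)) \<bullet> (J1kron Hp *\<^sub>v g n)) = 0"
  shows "\<forall>n\<le>nt. vnorm2 (psi n)
           \<le> sqrt (cond2 (Pmat hbar m dx dy dz nx ny nz U dt)) * vnorm2 (psi 0)"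
proof -
  obtain d where "DVm = mat_diag N d"
    using DV_eq_mat_diag[OF dxpos dypos dzpos] unfolding DVm_def N_def by blast
  then have D: "DVm \<in> carrier_mat N N" "transpose_mat DVm = DVm" by simp_all
  have H: "H \<in> carrier_mat N N" "transpose_mat H = H"
    using Hmat_carrier_symmetric[OF dxpos dypos dzpos] unfolding H_def N_def by blast+
  have Hp: "Hp \<in> carrier_mat N M" unfolding Hp_def N_def M_def by (rule Hperp_carrier)
  define P where "P = fdtd_energy_mat DVm H hbar dt"
  have P_eq: "Pmat hbar m dx dy dz nx ny nz U dt = P"
    unfolding P_def H_def DVm_def by (rule Pmat_eq_fdtd_energy_mat)
  have pd: "0 < (P *\<^sub>v z) \<bullet> z" if "z \<in> carrier_vec (N + N)" "z \<noteq> 0\<^sub>v (N + N)" for z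
    using Pmat_positive_definite[OF dxpos dypos dzpos hbar dtpos cfl] that unfolding P_eq N_def by blast
  have nonzero: "hbar \<noteq> 0" "dt \<noteq> 0" using hbar dtpos by simp_all
  have no_current: "probability_current hbar Hp (psiR (Suc j) @\<^sub>v psiI (Suc j))
      (psiR j @\<^sub>v psiI j) (gR j @\<^sub>v gI j) = 0" if "j < nt" for j
    using current[folded probability_current_def, OF that] by (simp add: psi_def g_def)
  have energy: "(P *\<^sub>v psi n) \<bullet> psi n = (P *\<^sub>v psi 0) \<bullet> psi 0" if "n \<le> nt" for n
    unfolding P_def psi_def
    by (rule fdtd_energy_conserved[where nt = nt and gR = gR and gI = gI, OF D H Hp])
      (fact nonzero dimR dimI dimgR dimgI schemeR schemeI no_current that)+
  have psi: "psi n \<in> carrier_vec (N + N)" if "n \<le> nt" for n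
    unfolding psi_def using dimR[OF that] dimI[OF that] by simp
  have "vnorm2 (psi n) \<le> sqrt (cond2 P) * vnorm2 (psi 0)" if "n \<le> nt" for n
    using vnorm2_le_sqrt_cond2_mult[OF fdtd_energy_mat_carrier_symmetric[OF D H, of hbar dt, folded P_def]
        pd psi[OF that] psi[OF le0] energy[OF that]] .
  then show ?thesis unfolding P_eq by blast
qed

end
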